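(* Let $X$ be a nonempty set and let $F\colon X^2\to X$ be an associative operation. Then $F$ is $(1,2)$-selective if and only if the following two conditions hold. (i) $F(x,y)=F(x,F(y,z))$ for all $x,y,z\in X$. (ii) $F|_{\mathrm{ran}(F)\times X}=\pi_1|_{\mathrm{ran}(F)\times X}$, that is, $F(x,y)=x$ for all $x\in\mathrm{ran}(F)$ and $y\in X$.
   Context: An operation $F\colon X^2\to X$ is $(1,2)$-selective if $F(F(x_1,x_2),F(x_3,x_4))=F(x_1,x_2)$ for all $x_1,x_2,x_3,x_4\in X$. $\mathrm{ran}(F)$ denotes the range of $F$, and $\pi_1(x,y)=x$ is the first projection. *)

theory Defs
  imports Main "HOL-Library.FuncSet"
begin

text \<open>A binary operation on a set \<open>X\<close> is a function \<open>F\<close> on pairs with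
  \<open>F \<in> X \<times> X \<rightarrow> X\<close>; its values outside \<open>X \<times> X\<close> are irrelevant.\<close>

definition associative_op :: "'a set \<Rightarrow> ('a \<times> 'a \<Rightarrow> 'a) \<Rightarrow> bool" where
  "associative_op X F \<longleftrightarrow>
     (\<forall>x\<in>X. \<forall>y\<in>X. \<forall>z\<in>X. F (F (x, y), z) = F (x, F (y, z)))"

definition selective_1_2 :: "'a set \<Rightarrow> ('a \<times> 'a \<Rightarrow> 'a) \<Rightarrow> bool" where
  "selective_1_2 X F \<longleftrightarrow>
     (\<forall>x1\<in>X. \<forall>x2\<in>X. \<forall>x3\<in>X. \<forall>x4\<in>X. F (F (x1, x2), F (x3, x4)) = F (x1, x2))"

definition ran_op :: "'a set \<Rightarrow> ('a \<times> 'a \<Rightarrow> 'a) \<Rightarrow> 'a set" where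
  "ran_op X F = F ` (X \<times> X)"

end

theory Submission
  imports Defs
begin

text \<open>By associativity, condition (i) reads \<open>xyz = xy\<close>, which is also what (ii) says about the
  elements \<open>xy\<close> of the range. Selectivity is \<open>xyzw = xy\<close>; grouping \<open>xyzst\<close> as
  \<open>(x(yz))(st)\<close> and as \<open>(xy)((zs)t)\<close> gives \<open>xyz = xy\<close>.\<close>

lemma selective_1_2_mult3:
  assumes F: "F \<in> X \<times> X \<rightarrow> X" and assoc: "associative_op X F" and sel: "selective_1_2 X F"
    and x: "x \<in> X" and y: "y \<in> X" and z: "z \<in> X"
  shows "F (F (x, y), z) = F (x, y)"
proof -
  have cl: "F (a, b) \<in> X" if "a \<in> X" "b \<in> X" for a b
    using F that by auto
  have as: "F (F (a, b), c) = F (a, F (b, c))" if "a \<in> X" "b \<in> X" "c \<in> X" for a b c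
    using assoc that by (simp add: associative_op_def)
  have se: "F (F (a, b), F (c, d)) = F (a, b)" if "a \<in> X" "b \<in> X" "c \<in> X" "d \<in> X" for a b c d
    using sel that by (simp add: selective_1_2_def)
  have "F (F (x, y), z) = F (x, F (y, z))"
    using x y z by (rule as)
  \<comment> \<open>Selectivity read backwards: \<open>F (x, F (y, z))\<close> absorbs any product
    on its right; here \<open>s\<close> and \<open>t\<close> are both \<open>z\<close>.\<close>
  also have "\<dots> = F (F (x, F (y, z)), F (z, z))"
    using x y z by (simp only: se cl)
  \<comment> \<open>Both sides share one right-nested form; the new grouping is again a product of
    two products, now led by \<open>F (x, y)\<close>.\<close>
  also have "\<dots> = F (F (x, y), F (F (z, z), z))"
    using x y z by (simp only: as cl)
  also have "\<dots> = F (x, y)"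
    using x y z by (simp only: se cl)
  finally show ?thesis .
qed

theorem proposition5p3:
  fixes X :: "'a set" and F :: "'a \<times> 'a \<Rightarrow> 'a"
  assumes "X \<noteq> {}"
    and "F \<in> X \<times> X \<rightarrow> X"
    and "associative_op X F"
  shows "selective_1_2 X F \<longleftrightarrow>
     (\<forall>x\<in>X. \<forall>y\<in>X. \<forall>z\<in>X. F (x, y) = F (x, F (y, z))) \<and>
     restrict F (ran_op X F \<times> X) = restrict fst (ran_op X F \<times> X)"
    (is "_ \<longleftrightarrow> ?i \<and> ?ii")
proof
  assume sel: "selective_1_2 X F"
  have mult3: "F (F (x, y), z) = F (x, y)" if "x \<in> X" "y \<in> X" "z \<in> X" for x y z
    using selective_1_2_mult3[OF assms(2,3) sel that] .
  then have ?i
    using assms(3) unfolding associative_op_def by metis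
  moreover have ?ii
    using mult3 by (intro restrict_ext) (auto simp: ran_op_def)
  ultimately show "?i \<and> ?ii" ..
next
  assume "?i \<and> ?ii"
  then have ii: "restrict F (ran_op X F \<times> X) = restrict fst (ran_op X F \<times> X)" ..
  \<comment> \<open>Evaluating the equal restrictions at a point of their common domain recovers
    (ii) pointwise.\<close>
  have proj: "F (r, y) = r" if "r \<in> ran_op X F" "y \<in> X" for r y
    using fun_cong[OF ii, of "(r, y)"] that by simp
  show "selective_1_2 X F"
    unfolding selective_1_2_def
  proof (intro ballI)
    fix x1 x2 x3 x4 assume x: "x1 \<in> X" "x2 \<in> X" "x3 \<in> X" "x4 \<in> X"
    show "F (F (x1, x2), F (x3, x4)) = F (x1, x2)"
      \<comment> \<open>Here \<open>r\<close> is \<open>F (x1, x2)\<close>, and closure puts the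
        second argument \<open>F (x3, x4)\<close> in \<open>X\<close>.\<close>
      using x assms(2) by (intro proj) (auto simp: ran_op_def)
  qed
qed

end
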